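(* Let $n\ge1$, $K=SU(2n)$, $I=\mathrm{diag}(\mathbf 1_n,-\mathbf 1_n)$ and $K_+=\{k\in K\mid k^\dagger Ik=I\}$. Let $C^\infty(K)^{K_+\times K_+}$ be the set of smooth real functions on $K$ that are invariant under both left- and right-multiplications by elements of $K_+$. Then any two elements of $C^\infty(K)^{K_+\times K_+}$ Poisson commute with respect to the Poisson bracket $\{\ ,\ \}_K$ of the context.
   Context: Let $B$ be the group of upper triangular complex $2n\times2n$ matrices of determinant $1$ with positive diagonal entries, and let $\mathcal{K}=su(2n)$ and $\mathcal{B}$ be the (real) Lie algebras of $K$ and $B$, so that $sl(2n,\mathbb{C})=\mathcal{K}+\mathcal{B}$ (direct sum of real vector spaces). For $f\in C^\infty(K)$ (real valued) the $\mathcal{B}$-valued left- and right-derivatives $Df,D'f$ are defined by $$\frac{d}{ds}\Big|_{s=0}f(e^{sX}ke^{sY})=\mathrm{Im}\,\mathrm{tr}\big(X\,Df(k)+Y\,D'f(k)\big),\qquad\forall X,Y\in\mathcal{K}.$$ The Poisson bracket on $C^\infty(K)$ is $$\{f,h\}_K(k)=\mathrm{Im}\,\mathrm{tr}\big(Df(k)\,k\,(D'h(k))\,k^{-1}\big),\qquad k\in K,\ f,h\in C^\infty(K).$$ *)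

theory Defs
  imports "HOL-Analysis.Analysis"
begin

text \<open>
  Matrices of size \<open>2n\<close> are indexed by \<open>'n + 'n\<close> with \<open>n = CARD('n)\<close>: the indices \<open>Inl i\<close> are the
  first \<open>n\<close> ones and \<open>Inr i\<close> the last \<open>n\<close> ones, each copy being ordered as \<open>'n\<close>.
\<close>

type_synonym 'n cmat = "complex^('n + 'n)^('n + 'n)"

fun idx_less :: "'n::linorder + 'n \<Rightarrow> 'n + 'n \<Rightarrow> bool" where
  "idx_less (Inl i) (Inl j) = (i < j)"
| "idx_less (Inl i) (Inr j) = True"
| "idx_less (Inr i) (Inl j) = False"
| "idx_less (Inr i) (Inr j) = (i < j)"

definition dagger :: "complex^'m^'m \<Rightarrow> complex^'m^'m" where
  "dagger A = (\<chi> i j. cnj (A $ j $ i))"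

text \<open>The operator \<open>*\<close> on vectors is componentwise, so the library's power and \<open>exp\<close> do not apply.\<close>

primrec matpow :: "complex^'m^'m \<Rightarrow> nat \<Rightarrow> complex^'m^'m" where
  "matpow A 0 = mat 1"
| "matpow A (Suc k) = A ** matpow A k"

definition mexp :: "complex^'m^'m \<Rightarrow> complex^'m^'m" where
  "mexp A = (\<Sum>k. (1 / fact k) *\<^sub>R matpow A k)"

text \<open>The Lie algebra of a closed linear group.\<close>

definition lie_algebra :: "(complex^'m^'m) set \<Rightarrow> (complex^'m^'m) set" where
  "lie_algebra G = {X. \<forall>s::real. mexp (s *\<^sub>R X) \<in> G}"

definition SU :: "(complex^'m^'m) set" where
  "SU = {k. dagger k ** k = mat 1 \<and> det k = 1}"

definition Bgrp :: "'n::{finite,linorder} cmat set" where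
  "Bgrp = {b. (\<forall>i j. idx_less j i \<longrightarrow> b $ i $ j = 0) \<and>
              (\<forall>i. b $ i $ i \<in> \<real> \<and> Re (b $ i $ i) > 0) \<and> det b = 1}"

definition Isig :: "'n::finite cmat" where
  "Isig = (\<chi> i j. if i = j then (case i of Inl _ \<Rightarrow> 1 | Inr _ \<Rightarrow> - 1) else 0)"

definition Kplus :: "'n::finite cmat set" where
  "Kplus = {k \<in> SU. dagger k ** Isig ** k = Isig}"

primrec Ck_on :: "nat \<Rightarrow> ('a::euclidean_space \<Rightarrow> real) \<Rightarrow> 'a set \<Rightarrow> bool" where
  "Ck_on 0 F U = continuous_on U F"
| "Ck_on (Suc m) F U = ((\<forall>x\<in>U. F differentiable (at x)) \<and>
     (\<forall>v. Ck_on m (\<lambda>x. frechet_derivative F (at x) v) U))"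

text \<open>
  Smoothness on a submanifold \<open>M\<close> of a Euclidean space, in terms of local smooth extensions.
  Only the values of \<open>f\<close> on \<open>M\<close> matter.
\<close>

definition smooth_on_submanifold :: "'a::euclidean_space set \<Rightarrow> ('a \<Rightarrow> real) \<Rightarrow> bool" where
  "smooth_on_submanifold M f \<longleftrightarrow>
     (\<forall>x\<in>M. \<exists>U F. open U \<and> x \<in> U \<and> (\<forall>m. Ck_on m F U) \<and> (\<forall>y\<in>M \<inter> U. F y = f y))"

definition Cinf :: "('n::finite cmat \<Rightarrow> real) set" where
  "Cinf = {f. smooth_on_submanifold SU f}"

definition Cinf_biinv :: "('n::finite cmat \<Rightarrow> real) set" where
  "Cinf_biinv = {f \<in> Cinf. \<forall>g\<in>Kplus. \<forall>k\<in>SU. f (g ** k) = f k \<and> f (k ** g) = f k}"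

text \<open>
  The pair \<open>(Df(k), D'f(k))\<close>. It exists and is unique for smooth \<open>f\<close>, because the pairing
  \<open>Im tr\<close> identifies the Lie algebra of \<open>B\<close> with the real dual of \<open>su(2n)\<close>.
\<close>

definition derivs ::
  "('n::{finite,linorder} cmat \<Rightarrow> real) \<Rightarrow> 'n cmat \<Rightarrow> 'n cmat \<times> 'n cmat" where
  "derivs f k = (THE (P, P'). P \<in> lie_algebra Bgrp \<and> P' \<in> lie_algebra Bgrp \<and>
     (\<forall>X\<in>lie_algebra SU. \<forall>Y\<in>lie_algebra SU.
        ((\<lambda>s::real. f (mexp (s *\<^sub>R X) ** k ** mexp (s *\<^sub>R Y)))
           has_real_derivative Im (trace (X ** P + Y ** P'))) (at 0)))"

definition Dleft :: "('n::{finite,linorder} cmat \<Rightarrow> real) \<Rightarrow> 'n cmat \<Rightarrow> 'n cmat" where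
  "Dleft f k = fst (derivs f k)"

definition Dright :: "('n::{finite,linorder} cmat \<Rightarrow> real) \<Rightarrow> 'n cmat \<Rightarrow> 'n cmat" where
  "Dright f k = snd (derivs f k)"

definition poisson ::
  "('n::{finite,linorder} cmat \<Rightarrow> real) \<Rightarrow> ('n cmat \<Rightarrow> real) \<Rightarrow> 'n cmat \<Rightarrow> real" where
  "poisson f h k = Im (trace (Dleft f k ** k ** Dright h k ** matrix_inv k))"

end

theory Submission
  imports Defs
begin

text \<open>
  For bi-invariant \<open>f\<close>, pairing with the Lie algebra of \<open>K\<^sub>+\<close> forces \<open>P = Df(k)\<close> and \<open>Q = D'f(k)\<close> to
  be strictly block upper triangular. The Hermitian part \<open>A\<^sub>f = P + P\<^sup>\<dagger>\<close> therefore anticommutes with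
  \<open>I\<close>; comparing left and right translations gives \<open>A\<^sub>f = k(Q + Q\<^sup>\<dagger>)k\<^sup>-\<^sup>1\<close>, so \<open>A\<^sub>f\<close> also anticommutes
  with \<open>J = kIk\<^sup>-\<^sup>1\<close>. The commutator \<open>Z = [A\<^sub>f, A\<^sub>h]\<close> then commutes with \<open>I\<close> and \<open>J\<close>, i.e. it lies in the
  Lie algebra of the stabilizer of \<open>k\<close> under the \<open>K\<^sub>+ \<times> K\<^sub>+\<close>-action. Invariance of \<open>f\<close> under this
  stabilizer gives \<open>[Z, A\<^sub>f] = 0\<close>, and as \<open>Z\<close> is anti-Hermitian, \<open>tr(Z\<^sup>2) = 0\<close> yields \<open>Z = 0\<close>, at
  every \<open>k\<close> and without a genericity assumption. Finally \<open>4{f, h}\<close> is the imaginary part of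
  \<open>tr((1 + I) A\<^sub>f A\<^sub>h (1 - J))\<close>, a sum of traces of products of two Hermitian matrices.
\<close>

section \<open>Complex matrices and the matrix exponential\<close>

text \<open>The type's own \<open>*\<close> is componentwise, so the product rule for derivatives
  and the termwise multiplication of series are obtained for \<open>**\<close> from bounded
  bilinearity.\<close>

lemma bounded_bilinear_cmatrix_mult:
  "bounded_bilinear ((**) :: complex^'m^'m \<Rightarrow> complex^'m^'m \<Rightarrow> complex^'m^'m)"
proof -
  have "bilinear ((**) :: complex^'m^'m \<Rightarrow> complex^'m^'m \<Rightarrow> complex^'m^'m)"
    by (auto simp: bilinear_def intro!: linearI)
      (simp_all add: vec_eq_iff matrix_matrix_mult_def algebra_simps sum.distrib scaleR_sum_right)
  then show ?thesis
    by (simp add: bilinear_conv_bounded_bilinear)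
qed

interpretation cmm: bounded_bilinear "(**) :: complex^'m^'m \<Rightarrow> complex^'m^'m \<Rightarrow> complex^'m^'m"
  by (rule bounded_bilinear_cmatrix_mult)

lemma has_vector_derivative_vecI:
  fixes f :: "real \<Rightarrow> ('a::real_normed_vector)^'n"
  assumes "\<And>i. ((\<lambda>s. f s $ i) has_vector_derivative f' $ i) (at x)"
  shows "(f has_vector_derivative f') (at x)"
  using assms unfolding has_vector_derivative_def has_derivative_def
  by (auto intro!: vec_tendstoI bounded_linear_intros)

lemma has_vector_derivative_vec_nth:
  assumes "(f has_vector_derivative f') F"
  shows "((\<lambda>s. f s $ i) has_vector_derivative f' $ i) F"
  using bounded_linear.has_vector_derivative[OF bounded_linear_vec_nth assms] .

section \<open>Adjoints and traces\<close>

lemma dagger_nth [simp]: "dagger A $ i $ j = cnj (A $ j $ i)"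
  by (simp add: dagger_def)

lemma dagger_dagger [simp]: "dagger (dagger A) = A"
  by (simp add: vec_eq_iff)

lemma dagger_mult: "dagger (A ** B) = dagger B ** dagger A"
  by (simp add: vec_eq_iff matrix_matrix_mult_def mult.commute)

lemma dagger_add: "dagger (A + B) = dagger A + dagger B"
  and dagger_diff: "dagger (A - B) = dagger A - dagger B"
  and dagger_minus: "dagger (- A) = - dagger A"
  by (simp_all add: vec_eq_iff)

lemma dagger_mat: "dagger (mat c) = mat (cnj c)"
  by (simp add: vec_eq_iff mat_def)

lemma bounded_linear_dagger: "bounded_linear (dagger :: complex^'m^'m \<Rightarrow> _)"
proof -
  have "linear (dagger :: complex^'m^'m \<Rightarrow> _)"
    by (auto intro!: linearI simp: vec_eq_iff)
  then show ?thesis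
    by (simp add: linear_conv_bounded_linear)
qed

lemma trace_dagger: "trace (dagger A) = cnj (trace A)"
  by (simp add: trace_def)

lemma mat_mult_nth: "(mat c ** A) $ i $ j = c * A $ i $ j"
  and mult_mat_nth: "(A ** mat c) $ i $ j = A $ i $ j * c"
  for A :: "complex^'m^'m"
  by (simp_all add: matrix_matrix_mult_def mat_def if_distrib[of "\<lambda>x. x * _"]
      if_distrib[of "\<lambda>x. _ * x"] cong: if_cong)

lemma mat_mult_commute: "mat c ** A = A ** mat c" for A :: "complex^'m^'m"
  by (simp add: vec_eq_iff mat_mult_nth mult_mat_nth mult.commute)

lemma trace_mat_mult: "trace (mat c ** A) = c * trace A" for A :: "complex^'m^'m"
  by (simp add: trace_def mat_mult_nth sum_distrib_left)

lemma trace_mult_eq: "trace (A ** B) = (\<Sum>i\<in>UNIV. \<Sum>j\<in>UNIV. A $ i $ j * B $ j $ i)"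
  by (simp add: trace_def matrix_matrix_mult_def)

lemma trace_minus: "trace (- A) = - trace A" for A :: "complex^'m^'m"
  by (simp add: trace_def sum_negf)

lemma trace_conj:
  fixes A B C :: "complex^'m^'m"
  assumes "B ** C = mat 1"
  shows "trace (C ** A ** B) = trace A"
  by (metis assms matrix_mul_assoc matrix_mul_lid trace_mul_sym)

text \<open>The adjoint reverses the two factors and cyclicity of the trace restores their order, so
  the trace is its own conjugate. The vanishing of the bracket is finally read off from
  this.\<close>

lemma trace_hermitian_mult:
  assumes "dagger A = A" "dagger B = B"
  shows "Im (trace (A ** B)) = 0"
proof -
  have "cnj (trace (A ** B)) = trace (dagger (A ** B))"
    by (simp add: trace_dagger)
  also have "\<dots> = trace (A ** B)"
    by (simp add: dagger_mult assms) (rule trace_mul_sym)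
  finally show ?thesis
    by (simp add: complex_eq_iff)
qed

lemma trace_dagger_mult_self: "trace (dagger A ** A) = of_real ((norm A)\<^sup>2)"
proof -
  have "(norm A)\<^sup>2 = (\<Sum>i\<in>UNIV. \<Sum>j\<in>UNIV. (norm (A $ i $ j))\<^sup>2)"
    by (simp add: power2_norm_eq_inner inner_vec_def)
  moreover have "trace (dagger A ** A) = (\<Sum>i\<in>UNIV. \<Sum>j\<in>UNIV. of_real ((norm (A $ j $ i))\<^sup>2))"
    unfolding trace_mult_eq
    by (intro sum.cong refl) (simp only: complex_norm_square dagger_nth mult.commute)
  ultimately show ?thesis
    by (subst (asm) sum.swap) simp
qed

section \<open>The exponential series and one-parameter groups\<close>

lemma matpow_commute: "matpow A k ** A = A ** matpow A k"
  by (induction k) (simp_all add: matrix_mul_assoc[symmetric])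

text \<open>Bounded bilinearity gives submultiplicativity up to a constant \<open>K\<close>; the
  majorant is a multiple of the scalar exponential series at \<open>norm A * K\<close>.\<close>

lemma summable_mexp: "summable (\<lambda>k. (1 / fact k) *\<^sub>R matpow A k)" for A :: "complex^'m^'m"
proof -
  have "\<exists>K>0. \<forall>(B :: complex^'m^'m) C :: complex^'m^'m. norm (B ** C) \<le> norm B * norm C * K"
    by (rule bounded_bilinear.pos_bounded[OF bounded_bilinear_cmatrix_mult])
  then obtain K where K: "K > 0" "\<And>(B :: complex^'m^'m) C :: complex^'m^'m. norm (B ** C) \<le> norm B * norm C * K"
    by auto
  have le: "norm (matpow A k) \<le> norm (mat 1 :: complex^'m^'m) * (norm A * K) ^ k" for k
  proof (induction k)
    case (Suc k)
    have "norm (matpow A (Suc k)) \<le> norm A * norm (matpow A k) * K"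
      using K(2)[of A "matpow A k"] by simp
    also have "\<dots> \<le> norm A * (norm (mat 1 :: complex^'m^'m) * (norm A * K) ^ k) * K"
      using Suc K by (intro mult_right_mono mult_left_mono) auto
    finally show ?case
      by (simp add: mult_ac)
  qed simp
  show ?thesis
  proof (rule summable_comparison_test')
    show "summable (\<lambda>k. norm (mat 1 :: complex^'m^'m) * (inverse (fact k) * (norm A * K) ^ k))"
      by (intro summable_mult summable_exp)
    show "norm ((1 / fact k) *\<^sub>R matpow A k)
        \<le> norm (mat 1 :: complex^'m^'m) * (inverse (fact k) * (norm A * K) ^ k)" if "k \<ge> 0" for k
      using le[of k] by (simp add: field_simps)
  qed
qed

lemma mexp_sums: "(\<lambda>k. (1 / fact k) *\<^sub>R matpow A k) sums mexp A"
  unfolding mexp_def by (rule summable_sums[OF summable_mexp])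

lemma mexp_nth_sums: "(\<lambda>k. matpow A k $ i $ j / fact k) sums (mexp A $ i $ j)"
proof -
  have "(\<lambda>k. ((1 / fact k) *\<^sub>R matpow A k) $ i $ j) sums (mexp A $ i $ j)"
    by (intro sums_vec_nth mexp_sums)
  then show ?thesis
    by (simp add: scaleR_conv_of_real[where 'a=complex] divide_simps)
qed

lemma matpow_scaleR: "matpow (s *\<^sub>R A) k = s ^ k *\<^sub>R matpow A k"
  by (induction k) (simp_all add: cmm.scaleR_left cmm.scaleR_right)

lemma mexp_scaleR_nth_sums:
  "(\<lambda>k. matpow A k $ i $ j / fact k * of_real s ^ k) sums (mexp (s *\<^sub>R A) $ i $ j)"
  using mexp_nth_sums[of "s *\<^sub>R A" i j]
  by (simp add: matpow_scaleR scaleR_conv_of_real[where 'a=complex] mult_ac)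

lemma mexp_zero [simp]: "mexp (0 :: complex^'m^'m) = mat 1"
proof -
  have "(\<lambda>k. (1 / fact k) *\<^sub>R matpow 0 k) sums (\<Sum>k\<in>{0}. (1 / fact k) *\<^sub>R matpow (0 :: complex^'m^'m) k)"
  proof (rule sums_finite)
    show "(1 / fact k) *\<^sub>R matpow (0 :: complex^'m^'m) k = 0" if "k \<notin> {0}" for k
      using that by (cases k) (auto simp: cmm.zero_left)
  qed simp
  then show ?thesis
    using mexp_sums[of "0 :: complex^'m^'m"] sums_unique2 by fastforce
qed

lemma mexp_commute: "mexp A ** A = A ** mexp A"
proof -
  have "(\<lambda>k. (1 / fact k) *\<^sub>R matpow A k ** A) sums (mexp A ** A)"
    by (rule bounded_linear.sums[OF cmm.bounded_linear_left mexp_sums])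
  moreover have "(\<lambda>k. A ** (1 / fact k) *\<^sub>R matpow A k) sums (A ** mexp A)"
    by (rule bounded_linear.sums[OF cmm.bounded_linear_right mexp_sums])
  ultimately show ?thesis
    by (simp add: cmm.scaleR_left cmm.scaleR_right matpow_commute sums_unique2)
qed

lemma mexp_conj:
  fixes A B C :: "complex^'m^'m"
  assumes "B ** C = mat 1"
  shows "mexp (C ** A ** B) = C ** mexp A ** B"
proof -
  have CB: "C ** B = mat 1"
    using assms matrix_left_right_inverse by blast
  have *: "matpow (C ** A ** B) k = C ** matpow A k ** B" for k
  proof (induction k)
    case (Suc k)
    have "(C ** A ** B) ** (C ** matpow A k ** B) = C ** A ** (B ** C) ** matpow A k ** B"
      by (simp only: matrix_mul_assoc)
    then show ?case
      using Suc by (simp add: assms matrix_mul_assoc)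
  qed (simp add: CB)
  have "(\<lambda>k. C ** (1 / fact k) *\<^sub>R matpow A k ** B) sums (C ** mexp A ** B)"
    by (intro bounded_linear.sums[OF cmm.bounded_linear_left]
        bounded_linear.sums[OF cmm.bounded_linear_right] mexp_sums)
  then show ?thesis
    using mexp_sums[of "C ** A ** B"]
    by (simp add: * cmm.scaleR_left cmm.scaleR_right sums_unique2)
qed

text \<open>Each entry is a power series in \<open>s\<close>, so termwise differentiation applies.
  In \<open>diffs\<close> the new factor cancels against the factorial and leaves the entry of
  \<open>A ** matpow A k\<close>.\<close>

lemma mexp_has_vector_derivative:
  "((\<lambda>s. mexp (s *\<^sub>R A)) has_vector_derivative (A ** mexp (s *\<^sub>R A))) (at s)"
  for A :: "complex^'m^'m"
proof (rule has_vector_derivative_vecI, rule has_vector_derivative_vecI)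
  fix i j
  define c where "c k = matpow A k $ i $ j / fact k" for k
  have summ: "summable (\<lambda>k. c k * z ^ k)" for z
  proof -
    \<comment> \<open>Convergence at a real point strictly beyond \<open>norm z\<close> implies
      convergence at the complex point \<open>z\<close>.\<close>
    have "summable (\<lambda>k. c k * of_real (norm z + 1) ^ k)"
      using mexp_scaleR_nth_sums[of A i j "norm z + 1"] unfolding c_def by (rule sums_summable)
    then show ?thesis
      by (rule powser_inside) (simp add: norm_of_real del: of_real_add)
  qed
  have "(\<Sum>k. c k * of_real t ^ k) = mexp (t *\<^sub>R A) $ i $ j" for t
    using mexp_scaleR_nth_sums[of A i j t] unfolding c_def by (rule sums_unique[symmetric])
  moreover have "(\<Sum>k. diffs c k * of_real s ^ k) = (A ** mexp (s *\<^sub>R A)) $ i $ j"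
  proof (rule sums_unique[symmetric])
    have "(\<lambda>k. \<Sum>l\<in>UNIV. A $ i $ l * (matpow A k $ l $ j / fact k * of_real s ^ k))
        sums (\<Sum>l\<in>UNIV. A $ i $ l * mexp (s *\<^sub>R A) $ l $ j)"
      by (intro sums_sum sums_mult mexp_scaleR_nth_sums)
    moreover have "(\<Sum>l\<in>UNIV. A $ i $ l * (matpow A k $ l $ j / fact k * of_real s ^ k))
        = diffs c k * of_real s ^ k" for k
    proof -
      have "diffs c k = (A ** matpow A k) $ i $ j / fact k"
        by (simp add: diffs_def c_def divide_simps del: of_nat_Suc)
      then show ?thesis
        by (simp add: matrix_matrix_mult_def sum_distrib_left sum_divide_distrib mult_ac)
    qed
    ultimately show "(\<lambda>k. diffs c k * of_real s ^ k) sums ((A ** mexp (s *\<^sub>R A)) $ i $ j)"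
      by (simp add: matrix_matrix_mult_def)
  qed
  ultimately show "((\<lambda>s. mexp (s *\<^sub>R A) $ i $ j) has_vector_derivative
      (A ** mexp (s *\<^sub>R A)) $ i $ j) (at s)"
    using has_vector_derivative_real_field[OF termdiffs_strong_converges_everywhere[OF summ, of "of_real s"]]
    by simp
qed

lemma has_vector_derivative_cmatrix_mult:
  fixes E F :: "real \<Rightarrow> complex^'m^'m"
  assumes "(E has_vector_derivative E') (at s)" "(F has_vector_derivative F') (at s)"
  shows "((\<lambda>s. E s ** F s) has_vector_derivative (E s ** F' + E' ** F s)) (at s)"
  using cmm.has_vector_derivative[OF assms] .

lemma constant_of_has_vector_derivative_zero:
  fixes E :: "real \<Rightarrow> 'a::real_normed_vector"
  assumes "\<And>s. (E has_vector_derivative 0) (at s)"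
  shows "E s = E t"
  using has_vector_derivative_zero_constant[of UNIV E]
  by (metis UNIV_I assms convex_UNIV has_vector_derivative_at_within)

lemma mexp_scaleR_commute: "mexp (s *\<^sub>R A) ** A = A ** mexp (s *\<^sub>R A)"
  for A :: "complex^'m^'m"
  using mexp_commute[of "s *\<^sub>R A"]
  by (cases "s = 0") (simp_all add: cmm.scaleR_left cmm.scaleR_right)

lemma mexp_neg_has_vector_derivative:
  "((\<lambda>s. mexp (- s *\<^sub>R A)) has_vector_derivative - (A ** mexp (- s *\<^sub>R A))) (at s)"
  for A :: "complex^'m^'m"
  using mexp_has_vector_derivative[of "- A" s] by (simp add: cmm.minus_left)

text \<open>\<open>A\<close> commutes with its exponential, so the derivative of the product cancels
  and the product keeps its value at 0. The addition formula after it follows the same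
  pattern.\<close>

lemma mexp_neg_mult: "mexp (- s *\<^sub>R A) ** mexp (s *\<^sub>R A) = mat 1" for A :: "complex^'m^'m"
proof -
  have "((\<lambda>s. mexp (- s *\<^sub>R A) ** mexp (s *\<^sub>R A)) has_vector_derivative 0) (at s)" for s
    using has_vector_derivative_cmatrix_mult[OF mexp_neg_has_vector_derivative[of A s] mexp_has_vector_derivative[of A s]]
      mexp_scaleR_commute[of "- s" A]
    by (simp add: matrix_mul_assoc cmm.minus_left)
  from constant_of_has_vector_derivative_zero[OF this, of s 0] show ?thesis
    by simp
qed

lemma mexp_scaleR_add: "mexp ((s + t) *\<^sub>R A) = mexp (s *\<^sub>R A) ** mexp (t *\<^sub>R A)"
  for A :: "complex^'m^'m"
proof -
  have shift: "((\<lambda>s. mexp ((s + t) *\<^sub>R A)) has_vector_derivative A ** mexp ((s + t) *\<^sub>R A)) (at s)" for s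
  proof -
    have "((\<lambda>s. s + t) has_vector_derivative 1) (at s)"
      by (auto intro!: derivative_eq_intros)
    from vector_diff_chain_at[OF this mexp_has_vector_derivative] show ?thesis
      by (simp add: o_def)
  qed
  have "((\<lambda>s. mexp (- s *\<^sub>R A) ** mexp ((s + t) *\<^sub>R A)) has_vector_derivative 0) (at s)" for s
    using has_vector_derivative_cmatrix_mult[OF mexp_neg_has_vector_derivative[of A s] shift[of s]]
      mexp_scaleR_commute[of "- s" A]
    by (simp add: matrix_mul_assoc cmm.minus_left)
  from constant_of_has_vector_derivative_zero[OF this, of s 0]
  have "mexp (- s *\<^sub>R A) ** mexp ((s + t) *\<^sub>R A) = mexp (t *\<^sub>R A)"
    by simp
  then have "mexp (s *\<^sub>R A) ** mexp (- s *\<^sub>R A) ** mexp ((s + t) *\<^sub>R A) = mexp (s *\<^sub>R A) ** mexp (t *\<^sub>R A)"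
    by (simp add: matrix_mul_assoc[symmetric])
  then show ?thesis
    using mexp_neg_mult[of "- s" A] by simp
qed

section \<open>The Lie algebra of SU\<close>

lemma mexp_has_vector_derivative_0:
  "((\<lambda>s. mexp (s *\<^sub>R A)) has_vector_derivative A) (at 0)" for A :: "complex^'m^'m"
  using mexp_has_vector_derivative[of A 0] by simp

lemma has_vector_derivative_prod:
  fixes f :: "'i \<Rightarrow> real \<Rightarrow> 'a::real_normed_field"
  assumes "\<And>i. i \<in> I \<Longrightarrow> (f i has_vector_derivative f' i) (at x)"
  shows "((\<lambda>s. \<Prod>i\<in>I. f i s) has_vector_derivative (\<Sum>i\<in>I. f' i * (\<Prod>j\<in>I - {i}. f j x))) (at x)"
  using has_derivative_prod[of I f "\<lambda>i s. s *\<^sub>R f' i" x UNIV] assms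
  by (simp add: has_vector_derivative_def scaleR_sum_right)

text \<open>In the Leibniz expansion the product rule leaves products over all indices but one. At
  the identity matrix such a product vanishes for every permutation other than \<open>id\<close>,
  which moves at least two indices; \<open>id\<close> contributes the trace.\<close>

lemma det_has_vector_derivative_at_mat_1:
  fixes E :: "real \<Rightarrow> complex^'m^'m"
  assumes "(E has_vector_derivative X) (at x)" "E x = mat 1"
  shows "((\<lambda>s. det (E s)) has_vector_derivative trace X) (at x)"
proof -
  have nth: "((\<lambda>s. E s $ i $ j) has_vector_derivative X $ i $ j) (at x)" for i j
    by (intro has_vector_derivative_vec_nth assms(1))
  let ?d = "\<lambda>p. \<Sum>i\<in>UNIV. X $ i $ p i * (\<Prod>j\<in>UNIV - {i}. E x $ j $ p j)"
  have "((\<lambda>s. det (E s)) has_vector_derivative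
      (\<Sum>p | p permutes UNIV. of_int (sign p) * ?d p)) (at x)"
    unfolding det_def
    by (intro has_vector_derivative_sum has_vector_derivative_mult_right has_vector_derivative_prod nth)
  also have "(\<Sum>p | p permutes UNIV. of_int (sign p) * ?d p)
      = (\<Sum>p | p permutes (UNIV :: 'm set). if p = id then trace X else 0)"
  proof (intro sum.cong refl)
    fix p :: "'m \<Rightarrow> 'm" assume "p \<in> {p. p permutes UNIV}"
    then have p: "p permutes UNIV" by simp
    show "of_int (sign p) * ?d p = (if p = id then trace X else 0)"
    proof (cases "p = id")
      case True
      then show ?thesis by (simp add: assms(2) mat_def trace_def)
    next
      case False
      have "(\<Prod>j\<in>UNIV - {i}. E x $ j $ p j) = 0" for i
      proof -
        obtain k where k: "p k \<noteq> k" using False by fastforce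
        have "p (p k) \<noteq> p k"
          using k permutes_inj[OF p] by (metis injD)
        then obtain j where "j \<noteq> i" "p j \<noteq> j" using k by metis
        then show ?thesis
          by (auto simp: assms(2) mat_def intro!: bexI[of _ j])
      qed
      then have "?d p = 0" by (simp only: mult_zero_right sum.neutral_const)
      then show ?thesis using False by (simp only: mult_zero_right if_False)
    qed
  qed
  also have "\<dots> = trace X"
    by (simp add: permutes_id)
  finally show ?thesis .
qed

text \<open>The derivative of the determinant is available only where a curve passes through the
  identity, so exp(tX) is split as exp((t - s)X) exp(sX) and differentiated at t = s.\<close>

lemma det_mexp_scaleR:
  fixes X :: "complex^'m^'m"
  assumes "trace X = 0"
  shows "det (mexp (s *\<^sub>R X)) = 1"
proof -
  have "((\<lambda>s. det (mexp (s *\<^sub>R X))) has_vector_derivative 0) (at s)" for s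
  proof -
    let ?E = "\<lambda>t. mexp ((t - s) *\<^sub>R X)"
    have "(?E has_vector_derivative X) (at s)"
    proof -
      have *: "((\<lambda>t. t - s) has_vector_derivative 1) (at s)"
        by (auto intro!: derivative_eq_intros)
      from vector_diff_chain_at[OF this, of "\<lambda>s. mexp (s *\<^sub>R X)" X] show ?thesis
        by (simp add: o_def mexp_has_vector_derivative_0)
    qed
    from det_has_vector_derivative_at_mat_1[OF this]
    have "((\<lambda>t. det (?E t)) has_vector_derivative 0) (at s)"
      by (simp add: assms)
    then have "((\<lambda>t. det (?E t) * det (mexp (s *\<^sub>R X))) has_vector_derivative 0) (at s)"
      using has_vector_derivative_mult_left by fastforce
    moreover have "det (?E t) * det (mexp (s *\<^sub>R X)) = det (mexp (t *\<^sub>R X))" for t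
      using mexp_scaleR_add[of "t - s" s X] by (simp add: det_mul)
    ultimately show ?thesis by simp
  qed
  from constant_of_has_vector_derivative_zero[OF this, of s 0] show ?thesis by simp
qed

lemma trace_eq_0_if_det_mexp:
  fixes X :: "complex^'m^'m"
  assumes "\<And>s. det (mexp (s *\<^sub>R X)) = 1"
  shows "trace X = 0"
  using det_has_vector_derivative_at_mat_1[OF mexp_has_vector_derivative_0[of X]] assms
  by (simp add: vector_derivative_unique_at)

definition su :: "(complex^'m^'m) set" where
  "su = {X. dagger X = - X \<and> trace X = 0}"

lemma SU_D:
  assumes "k \<in> SU"
  shows "dagger k ** k = mat 1" "k ** dagger k = mat 1" "det k = 1" "matrix_inv k = dagger k"
proof -
  show 1: "dagger k ** k = mat 1" "det k = 1"
    using assms by (auto simp: SU_def)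
  then show 2: "k ** dagger k = mat 1"
    using matrix_left_right_inverse by blast
  \<comment> \<open>\<open>matrix_inv\<close> is a choice of a two-sided inverse;
    \<open>dagger k\<close> witnesses that one exists.\<close>
  have "k ** matrix_inv k = mat 1"
    using someI_ex[of "\<lambda>l. k ** l = mat 1 \<and> l ** k = mat 1"] 1 2
    unfolding matrix_inv_def by blast
  then have "dagger k ** (k ** matrix_inv k) = dagger k" by simp
  then show "matrix_inv k = dagger k" by (simp add: matrix_mul_assoc 1)
qed

lemma SU_mult: "k \<in> SU \<Longrightarrow> l \<in> SU \<Longrightarrow> k ** l \<in> SU"
  and SU_dagger: "k \<in> SU \<Longrightarrow> dagger k \<in> SU"
proof -
  assume k: "k \<in> SU"
  have "det (dagger k) * det k = 1"
    using SU_D(1)[OF k] by (metis det_mul det_I)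
  then show "dagger k \<in> SU"
    using SU_D[OF k] by (simp add: SU_def)
  assume l: "l \<in> SU"
  have "dagger (k ** l) ** (k ** l) = dagger l ** (dagger k ** k) ** l"
    by (simp only: dagger_mult matrix_mul_assoc)
  then show "k ** l \<in> SU"
    using SU_D[OF k] SU_D[OF l] by (simp add: SU_def det_mul)
qed

lemma dagger_scaleR: "dagger (s *\<^sub>R A) = s *\<^sub>R dagger A"
  by (simp add: vec_eq_iff)

lemma dagger_mexp: "dagger (mexp A) = mexp (dagger A)"
proof -
  have "matpow (dagger A) k = dagger (matpow A k)" for k
  proof (induction k)
    case (Suc k)
    then show ?case
      by (metis dagger_mult matpow.simps(2) matpow_commute)
  qed (simp add: dagger_mat)
  then have "(\<lambda>k. dagger ((1 / fact k) *\<^sub>R matpow A k)) sums mexp (dagger A)"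
    using mexp_sums[of "dagger A"]
    by (simp add: dagger_scaleR)
  moreover have "(\<lambda>k. dagger ((1 / fact k) *\<^sub>R matpow A k)) sums dagger (mexp A)"
    by (rule bounded_linear.sums[OF bounded_linear_dagger mexp_sums])
  ultimately show ?thesis
    using sums_unique2 by blast
qed

text \<open>One inclusion exponentiates; the other differentiates unitarity and the determinant
  condition at s = 0.\<close>

lemma lie_algebra_SU: "lie_algebra SU = (su :: (complex^'m^'m) set)"
proof (intro set_eqI iffI)
  fix X :: "complex^'m^'m"
  assume "X \<in> su"
  then have X: "dagger X = - X" "trace X = 0"
    by (simp_all add: su_def)
  have "mexp (s *\<^sub>R X) \<in> SU" for s
    using mexp_neg_mult[of s X] X(1)
    by (simp add: SU_def det_mexp_scaleR[OF X(2)] dagger_mexp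
        dagger_scaleR)
  then show "X \<in> lie_algebra SU"
    by (simp add: lie_algebra_def)
next
  fix X :: "complex^'m^'m"
  assume "X \<in> lie_algebra SU"
  then have X: "mexp (s *\<^sub>R X) \<in> SU" for s
    by (simp add: lie_algebra_def)
  have "trace X = 0"
    by (rule trace_eq_0_if_det_mexp) (rule SU_D(3)[OF X])
  moreover have "((\<lambda>s. dagger (mexp (s *\<^sub>R X)) ** mexp (s *\<^sub>R X)) has_vector_derivative
      (dagger (mexp (0 *\<^sub>R X)) ** X + dagger X ** mexp (0 *\<^sub>R X))) (at 0)"
    by (intro has_vector_derivative_cmatrix_mult mexp_has_vector_derivative_0
        bounded_linear.has_vector_derivative[OF bounded_linear_dagger])
  then have "X + dagger X = 0"
    using vector_derivative_unique_at[OF has_vector_derivative_const[of "mat 1"]] SU_D(1)[OF X]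
    by (fastforce simp: dagger_mat)
  ultimately show "X \<in> su"
    by (simp add: su_def eq_neg_iff_add_eq_0 add.commute)
qed

section \<open>The Lie algebra of Bgrp and its pairing with su\<close>

definition upper_triangular :: "'n::{finite,linorder} cmat \<Rightarrow> bool" where
  "upper_triangular A \<longleftrightarrow> (\<forall>i j. idx_less j i \<longrightarrow> A $ i $ j = 0)"

text \<open>The infinitesimal form of \<open>Bgrp\<close>: positivity of the diagonal leaves only
  its reality, and determinant one becomes trace zero.\<close>

definition bt :: "'n::{finite,linorder} cmat set" where
  "bt = {P. upper_triangular P \<and> (\<forall>i. P $ i $ i \<in> \<real>) \<and> trace P = 0}"

lemma idx_less_irrefl [simp]: "\<not> idx_less i i"
  by (cases i) auto

lemma idx_less_trans: "idx_less i j \<Longrightarrow> idx_less j k \<Longrightarrow> idx_less i k"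
  by (cases i; cases j; cases k) auto

lemma idx_less_total: "idx_less i j \<or> i = j \<or> idx_less j i"
  by (cases i; cases j) auto

lemma upper_triangular_mult:
  assumes "upper_triangular A" "upper_triangular B"
  shows "upper_triangular (A ** B)" "(A ** B) $ i $ i = A $ i $ i * B $ i $ i"
proof -
  \<comment> \<open>A summand survives only if \<open>l\<close> lies weakly between \<open>i\<close>
    and \<open>j\<close> in the order, which is impossible below the diagonal and forces l = i on
    it.\<close>
  have 0: "A $ i $ l * B $ l $ j = 0" if "idx_less j i \<or> i = j \<and> l \<noteq> i" for i j l
    using assms that idx_less_total[of l i] idx_less_trans[of j i l]
    unfolding upper_triangular_def by auto
  then show "upper_triangular (A ** B)"
    by (simp add: upper_triangular_def matrix_matrix_mult_def sum.neutral del: mult_eq_0_iff)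
  have "(\<Sum>l\<in>UNIV. A $ i $ l * B $ l $ i) = (\<Sum>l\<in>{i}. A $ i $ l * B $ l $ i)"
    by (rule sum.mono_neutral_right) (use 0 in auto)
  then show "(A ** B) $ i $ i = A $ i $ i * B $ i $ i"
    by (simp add: matrix_matrix_mult_def)
qed

lemma upper_triangular_matpow:
  assumes "upper_triangular A"
  shows "upper_triangular (matpow A k)" "matpow A k $ i $ i = (A $ i $ i) ^ k"
proof -
  have "upper_triangular (matpow A k) \<and> (\<forall>i. matpow A k $ i $ i = (A $ i $ i) ^ k)"
    by (induction k) (auto simp: upper_triangular_mult[OF assms], auto simp: upper_triangular_def mat_def)
  then show "upper_triangular (matpow A k)" "matpow A k $ i $ i = (A $ i $ i) ^ k"
    by auto
qed

lemma upper_triangular_mexp: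
  assumes "upper_triangular A"
  shows "upper_triangular (mexp A)" "mexp A $ i $ i = exp (A $ i $ i)"
proof -
  have "mexp A $ i $ j = 0" if "idx_less j i" for i j
    using mexp_nth_sums[of A i j] upper_triangular_matpow(1)[OF assms] that
    by (simp add: upper_triangular_def sums_iff)
  then show "upper_triangular (mexp A)"
    by (simp add: upper_triangular_def)
  show "mexp A $ i $ i = exp (A $ i $ i)"
    using mexp_nth_sums[of A i i] sums_unique2[OF _ exp_converges[of "A $ i $ i"]]
    by (simp add: upper_triangular_matpow(2)[OF assms] scaleR_conv_of_real[where 'a=complex] field_simps)
qed

lemma has_vector_derivative_zero_if_const_on:
  assumes "(E has_vector_derivative E') (at s)" "\<And>s. E s = c"
  shows "E' = 0"
  using assms vector_derivative_unique_at[OF has_vector_derivative_const[of c]]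
  by (metis ext)

text \<open>Entries below the diagonal and imaginary parts on it vanish along the whole curve
  exp(sP), hence so do their derivatives at 0. Conversely, the diagonal of exp(sP) consists of
  exponentials of real numbers.\<close>

lemma lie_algebra_Bgrp: "lie_algebra Bgrp = (bt :: 'n::{finite,linorder} cmat set)"
proof (intro set_eqI iffI)
  fix P :: "'n cmat"
  assume "P \<in> bt"
  then have P: "upper_triangular P" "\<And>i. P $ i $ i \<in> \<real>" "trace P = 0"
    by (simp_all add: bt_def)
  have "mexp (s *\<^sub>R P) \<in> Bgrp" for s
  proof -
    have ut: "upper_triangular (s *\<^sub>R P)"
      using P(1) by (simp add: upper_triangular_def)
    have "exp ((s *\<^sub>R P) $ i $ i) = of_real (exp (s * Re (P $ i $ i)))" for i
      using P(2)[of i] by (simp add: exp_of_real[symmetric] scaleR_conv_of_real[where 'a=complex])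
    then show ?thesis
      using upper_triangular_mexp[OF ut]
      by (simp add: Bgrp_def upper_triangular_def det_mexp_scaleR[OF P(3)] del: vector_scaleR_component)
  qed
  then show "P \<in> lie_algebra Bgrp"
    by (simp add: lie_algebra_def)
next
  fix P :: "'n cmat"
  assume "P \<in> lie_algebra Bgrp"
  then have P: "mexp (s *\<^sub>R P) \<in> Bgrp" for s
    by (simp add: lie_algebra_def)
  have nth: "((\<lambda>s. mexp (s *\<^sub>R P) $ i $ j) has_vector_derivative P $ i $ j) (at 0)" for i j
    by (intro has_vector_derivative_vec_nth mexp_has_vector_derivative_0)
  have "trace P = 0"
    by (rule trace_eq_0_if_det_mexp) (use P in \<open>simp add: Bgrp_def\<close>)
  moreover have "upper_triangular P"
    using P has_vector_derivative_zero_if_const_on[OF nth]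
    unfolding upper_triangular_def Bgrp_def by blast
  moreover have "P $ i $ i \<in> \<real>" for i
  proof -
    have "Im (P $ i $ i) = 0"
      by (rule has_vector_derivative_zero_if_const_on
          [OF bounded_linear.has_vector_derivative[OF bounded_linear_Im nth[of i i]]])
        (use P in \<open>auto simp: Bgrp_def complex_is_Real_iff\<close>)
    then show ?thesis
      by (simp add: complex_is_Real_iff)
  qed
  ultimately show "P \<in> bt"
    by (simp add: bt_def)
qed

text \<open>For \<open>Re (tr D) = 0\<close>, \<open>X = \<i>(D + D\<^sup>\<dagger>)\<close> lies in \<open>su\<close>; it pairs with \<open>D\<close> to half the squared norm of \<open>D + D\<^sup>\<dagger>\<close>.\<close>

lemma trace_hermitian_part:
  "Im (trace (mat \<i> ** (D + dagger D) ** D)) = (norm (D + dagger D))\<^sup>2 / 2"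
proof -
  let ?S = "D + dagger D"
  have S: "dagger ?S = ?S"
    by (simp add: dagger_add add.commute)
  have "trace (?S ** dagger D) = cnj (trace (?S ** D))"
    by (metis trace_dagger dagger_mult S trace_mul_sym)
  moreover have "trace (?S ** ?S) = trace (?S ** D) + trace (?S ** dagger D)"
    by (simp only: cmm.add_right trace_add)
  moreover have "Re (trace (?S ** ?S)) = (norm ?S)\<^sup>2"
    using trace_dagger_mult_self[of ?S] S by simp
  moreover have "trace (mat \<i> ** ?S ** D) = \<i> * trace (?S ** D)"
    by (simp only: trace_mat_mult matrix_mul_assoc[symmetric])
  ultimately show ?thesis
    by simp
qed

text \<open>This is how identities for Df and D'f are obtained: equality tested against
  \<open>su\<close> alone determines the Hermitian part. The condition on the trace makes the test
  element traceless.\<close>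

lemma dagger_eq_minus_if_su_orthogonal:
  assumes "Re (trace D) = 0" "\<And>X. X \<in> su \<Longrightarrow> Im (trace (X ** D)) = 0"
  shows "dagger D = - D"
proof -
  have "mat \<i> ** (D + dagger D) \<in> su"
    using assms(1)
    by (simp add: su_def dagger_mult dagger_mat dagger_add trace_mat_mult trace_add trace_dagger complex_eq_iff)
      (simp add: vec_eq_iff mat_mult_nth mult_mat_nth algebra_simps)
  from assms(2)[OF this] have "D + dagger D = 0"
    by (simp add: trace_hermitian_part)
  then show ?thesis
    by (simp add: eq_neg_iff_add_eq_0 add.commute)
qed

text \<open>The reason why the Lie algebras of \<open>SU\<close> and \<open>Bgrp\<close> meet only
  in 0: anti-Hermitian symmetry reflects the zeros across the diagonal, where the entries are both
  real and imaginary.\<close>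

lemma upper_triangular_antihermitian_zero:
  assumes "upper_triangular P" "\<And>i. P $ i $ i \<in> \<real>" "dagger P = - P"
  shows "P = 0"
proof -
  have *: "cnj (P $ j $ i) = - P $ i $ j" for i j
    using arg_cong[OF assms(3), of "\<lambda>A. A $ i $ j"] by simp
  have "P $ i $ j = 0" for i j
  proof -
    consider "idx_less j i" | "i = j" | "idx_less i j"
      using idx_less_total by blast
    then show ?thesis
    proof cases
      case 1
      then show ?thesis using assms(1) by (simp add: upper_triangular_def)
    next
      case 2
      then show ?thesis using *[of i i] assms(2)[of i] by (simp add: Reals_cnj_iff)
    next
      case 3
      then show ?thesis using assms(1) *[of i j] by (simp add: upper_triangular_def)
    qed
  qed
  then show ?thesis
    by (simp add: vec_eq_iff)
qed

text \<open>\<open>su\<close> is isotropic for the pairing Im tr, so a matrix representing a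
  functional on \<open>su\<close> may be altered by an anti-Hermitian one.\<close>

lemma Im_trace_antihermitian_mult:
  assumes "dagger X = - X" "dagger Y = - Y"
  shows "Im (trace (X ** Y)) = 0"
proof -
  have "cnj (trace (X ** Y)) = trace (dagger (X ** Y))"
    by (simp add: trace_dagger)
  also have "\<dots> = trace (Y ** X)"
    by (simp add: dagger_mult assms cmm.minus_left cmm.minus_right)
  also have "\<dots> = trace (X ** Y)"
    by (rule trace_mul_sym)
  finally show ?thesis
    by (simp add: complex_eq_iff)
qed

section \<open>Existence and uniqueness of the derivatives\<close>

lemma bt_diff: "P \<in> bt \<Longrightarrow> Q \<in> bt \<Longrightarrow> P - Q \<in> bt"
  by (auto simp: bt_def upper_triangular_def trace_sub)

lemma bt_eqI:
  assumes "P \<in> bt" "Q \<in> bt" "\<And>X. X \<in> su \<Longrightarrow> Im (trace (X ** P)) = Im (trace (X ** Q))"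
  shows "P = Q"
proof -
  have bt: "P - Q \<in> bt"
    by (rule bt_diff[OF assms(1,2)])
  have "dagger (P - Q) = - (P - Q)"
    by (rule dagger_eq_minus_if_su_orthogonal)
      (use bt assms(3) in \<open>auto simp: bt_def cmm.diff_right trace_sub\<close>)
  with bt have "P - Q = 0"
    by (intro upper_triangular_antihermitian_zero) (auto simp: bt_def)
  then show ?thesis by simp
qed

lemma linear_functional_eq_Im_trace:
  fixes L :: "complex^'m^'m \<Rightarrow> real"
  assumes "linear L"
  obtains M where "\<And>X. L X = Im (trace (X ** M))"
proof
  \<comment> \<open>\<open>adjoint L 1\<close> is the Riesz vector of \<open>L\<close> for the real
    inner product; the matrix \<open>\<i>\<close> times its adjoint turns that inner product into Im
    tr.\<close>
  let ?G = "adjoint L 1"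
  have "Im (trace (X ** (\<chi> j i. \<i> * cnj (?G $ i $ j)))) = X \<bullet> ?G" for X
    by (simp add: trace_mult_eq inner_vec_def inner_complex_def)
  then show "L X = Im (trace (X ** (\<chi> j i. \<i> * cnj (?G $ i $ j))))" for X
    using adjoint_works[OF assms, of X 1] by simp
qed

text \<open>The existence counterpart of \<open>bt_eqI\<close>. The adjoint of the lower triangle of
  \<open>M\<close> is folded onto the upper one and the imaginary parts of the diagonal are dropped;
  subtracting the mean \<open>c\<close> then makes the trace vanish.\<close>

lemma bt_representative:
  fixes L :: "'n::{finite,linorder} cmat \<Rightarrow> real"
  assumes "linear L"
  obtains P where "P \<in> bt" "\<And>X. X \<in> su \<Longrightarrow> L X = Im (trace (X ** P))"
proof -
  obtain M where M: "\<And>X. L X = Im (trace (X ** M))"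
    using linear_functional_eq_Im_trace[OF assms] by blast
  \<comment> \<open>\<open>P - M\<close> is an anti-Hermitian plus a scalar matrix, both of which are orthogonal to \<open>su\<close>.\<close>
  define c where "c = Re (trace M) / of_nat CARD('n + 'n)"
  define P :: "'n cmat" where
    "P = (\<chi> i j. if idx_less i j then M $ i $ j + cnj (M $ j $ i)
      else if i = j then of_real (Re (M $ i $ i) - c) else 0)"
  have asym: "\<not> idx_less j i" if "idx_less i j" for i j :: "'n + 'n"
    using that idx_less_trans[of i j i] by auto
  have "trace P = of_real (Re (trace M) - of_nat CARD('n + 'n) * c)"
    by (simp add: trace_def P_def sum_subtractf)
  also have "\<dots> = 0"
    by (simp add: c_def)
  finally have "P \<in> bt"
    using asym by (auto simp: bt_def upper_triangular_def P_def)
  moreover have "L X = Im (trace (X ** P))" if X: "X \<in> su" for X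
  proof -
    let ?Y = "P - M + mat (of_real c)"
    have "dagger ?Y $ i $ j = (- ?Y) $ i $ j" for i j
      using idx_less_total[of i j] asym[of i j]
      by (auto simp: P_def mat_def complex_eq_iff)
    then have "dagger ?Y = - ?Y"
      by (simp add: vec_eq_iff)
    then have "Im (trace (X ** ?Y)) = 0"
      using X by (intro Im_trace_antihermitian_mult) (simp_all add: su_def)
    moreover have "trace (X ** mat (of_real c)) = 0"
      using X by (simp add: mat_mult_commute[symmetric] trace_mat_mult su_def)
    ultimately show ?thesis
      by (simp add: M cmm.add_right cmm.diff_right trace_add trace_sub)
  qed
  ultimately show thesis
    using that by blast
qed

lemma su_zero [simp]: "0 \<in> su"
  by (simp add: su_def trace_def vec_eq_iff)

lemma mexp_su_in_SU: "X \<in> su \<Longrightarrow> mexp (s *\<^sub>R X) \<in> SU"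
  using lie_algebra_SU by (auto simp: lie_algebra_def)

text \<open>\<open>L\<close> is the derivative at \<open>k\<close> of a local extension of
  \<open>f\<close>. One linear map serves left and right translations at once, since the curve has
  velocity Xk + kY at s = 0.\<close>

lemma Cinf_has_derivative_on_SU:
  fixes f :: "'n::finite cmat \<Rightarrow> real"
  assumes "f \<in> Cinf" "k \<in> SU"
  obtains L where "linear L"
    "\<And>X Y. X \<in> su \<Longrightarrow> Y \<in> su \<Longrightarrow>
      ((\<lambda>s. f (mexp (s *\<^sub>R X) ** k ** mexp (s *\<^sub>R Y))) has_real_derivative L (X ** k + k ** Y)) (at 0)"
proof -
  have "\<exists>U F. open U \<and> k \<in> U \<and> (\<forall>m. Ck_on m F U) \<and> (\<forall>y\<in>SU \<inter> U. F y = f y)"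
    using assms by (simp add: Cinf_def smooth_on_submanifold_def)
  then obtain U F where UF: "open U" "k \<in> U" "\<forall>m. Ck_on m F U" "\<forall>y\<in>SU \<inter> U. F y = f y"
    by blast
  from UF(3) have "Ck_on (Suc 0) F U" ..
  with UF(2) obtain L where L: "(F has_derivative L) (at k)"
    by (auto simp: differentiable_def)
  show thesis
  proof (rule that[OF has_derivative_linear[OF L]])
    fix X Y :: "'n cmat"
    assume XY: "X \<in> su" "Y \<in> su"
    let ?g = "\<lambda>s. mexp (s *\<^sub>R X) ** k ** mexp (s *\<^sub>R Y)"
    have g: "(?g has_vector_derivative (X ** k + k ** Y)) (at 0)"
      using has_vector_derivative_cmatrix_mult[OF has_vector_derivative_cmatrix_mult[OF
          mexp_has_vector_derivative_0[of X] has_vector_derivative_const[of k]]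
          mexp_has_vector_derivative_0[of Y]]
      by (simp add: cmm.zero_right add.commute)
    then have "((F \<circ> ?g) has_derivative (L \<circ> (\<lambda>s. s *\<^sub>R (X ** k + k ** Y)))) (at 0)"
      unfolding has_vector_derivative_def using L
      by (intro diff_chain_at) simp_all
    then have deriv: "(F \<circ> ?g has_real_derivative L (X ** k + k ** Y)) (at 0)"
      by (rule has_derivative_imp_has_field_derivative)
        (simp add: linear_scale[OF has_derivative_linear[OF L]])
    \<comment> \<open>The extension agrees with \<open>f\<close> only on the part of
      \<open>SU\<close> inside \<open>U\<close>. The curve lies in \<open>SU\<close> and is in
      \<open>U\<close> for small \<open>s\<close>, which suffices to transfer the
      derivative.\<close>
    have eq: "\<forall>\<^sub>F s in nhds 0. (F \<circ> ?g) s = f (?g s)"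
    proof -
      have "isCont ?g 0"
        using g has_vector_derivative_continuous by blast
      then have "\<forall>\<^sub>F s in nhds 0. ?g s \<in> U"
        unfolding isCont_def tendsto_at_iff_tendsto_nhds[of ?g 0]
        by (rule topological_tendstoD[OF _ UF(1)]) (simp add: UF(2))
      then show ?thesis
        by (rule eventually_mono)
          (use UF(4) XY assms(2) in \<open>auto intro!: SU_mult mexp_su_in_SU\<close>)
    qed
    show "((\<lambda>s. f (?g s)) has_real_derivative L (X ** k + k ** Y)) (at 0)"
      by (rule iffD1[OF DERIV_cong_ev[OF refl eq refl] deriv])
  qed
qed

text \<open>Discharges the definite description in \<open>derivs\<close>: existence represents the
  functionals L(Xk) and L(kY) separately, and uniqueness is that of representatives in
  \<open>bt\<close>.\<close>

lemma derivs_characterization: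
  fixes f :: "'n::{finite,linorder} cmat \<Rightarrow> real"
  assumes "f \<in> Cinf" "k \<in> SU"
  shows "Dleft f k \<in> bt" "Dright f k \<in> bt"
    "\<And>X Y. X \<in> su \<Longrightarrow> Y \<in> su \<Longrightarrow>
      ((\<lambda>s. f (mexp (s *\<^sub>R X) ** k ** mexp (s *\<^sub>R Y)))
        has_real_derivative Im (trace (X ** Dleft f k + Y ** Dright f k))) (at 0)"
proof -
  let ?Q = "\<lambda>(P, P'). P \<in> bt \<and> P' \<in> bt \<and> (\<forall>X\<in>su. \<forall>Y\<in>su.
    ((\<lambda>s. f (mexp (s *\<^sub>R X) ** k ** mexp (s *\<^sub>R Y)))
      has_real_derivative Im (trace (X ** P + Y ** P'))) (at 0))"
  obtain L where L: "linear L"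
    "\<And>X Y. X \<in> su \<Longrightarrow> Y \<in> su \<Longrightarrow>
      ((\<lambda>s. f (mexp (s *\<^sub>R X) ** k ** mexp (s *\<^sub>R Y))) has_real_derivative L (X ** k + k ** Y)) (at 0)"
    by (rule Cinf_has_derivative_on_SU[OF assms]) (rule that)
  have "linear (\<lambda>X. L (X ** k))"
    using linear_compose[OF bounded_linear.linear[OF cmm.bounded_linear_left] L(1)]
    by (simp add: o_def)
  then obtain P where P: "P \<in> bt" "\<And>X. X \<in> su \<Longrightarrow> L (X ** k) = Im (trace (X ** P))"
    by (rule bt_representative) (rule that)
  have "linear (\<lambda>Y. L (k ** Y))"
    using linear_compose[OF bounded_linear.linear[OF cmm.bounded_linear_right] L(1)]
    by (simp add: o_def)
  then obtain P' where P': "P' \<in> bt" "\<And>Y. Y \<in> su \<Longrightarrow> L (k ** Y) = Im (trace (Y ** P'))"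
    by (rule bt_representative) (rule that)
  have ex: "?Q (P, P')"
    using L P P' by (simp add: linear_add trace_add)
  have "p = (P, P')" if "?Q p" for p
  proof -
    obtain R R' where p: "p = (R, R')" by (cases p)
    have eq: "Im (trace (X ** R + Y ** R')) = Im (trace (X ** P + Y ** P'))" if "X \<in> su" "Y \<in> su" for X Y
    proof (rule DERIV_unique)
      let ?g = "\<lambda>s. f (mexp (s *\<^sub>R X) ** k ** mexp (s *\<^sub>R Y))"
      show "(?g has_real_derivative Im (trace (X ** R + Y ** R'))) (at 0)"
        using that \<open>?Q p\<close> unfolding p by simp
      show "(?g has_real_derivative Im (trace (X ** P + Y ** P'))) (at 0)"
        using that ex by simp
    qed
    \<comment> \<open>Setting Y = 0, and below X = 0, separates the two components.\<close>
    have "R = P"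
      using eq[OF _ su_zero] \<open>?Q p\<close> P(1) unfolding p by (intro bt_eqI) (auto simp: cmm.zero_left)
    moreover have "R' = P'"
      using eq[OF su_zero] \<open>?Q p\<close> P'(1) unfolding p by (intro bt_eqI) (auto simp: cmm.zero_left)
    ultimately show ?thesis
      using p by simp
  qed
  with ex have "?Q (derivs f k)"
    unfolding derivs_def lie_algebra_SU lie_algebra_Bgrp by (rule theI[where P = ?Q])
  then show "Dleft f k \<in> bt" "Dright f k \<in> bt"
    "\<And>X Y. X \<in> su \<Longrightarrow> Y \<in> su \<Longrightarrow>
      ((\<lambda>s. f (mexp (s *\<^sub>R X) ** k ** mexp (s *\<^sub>R Y)))
        has_real_derivative Im (trace (X ** Dleft f k + Y ** Dright f k))) (at 0)"
    by (auto simp: Dleft_def Dright_def split: prod.splits)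
qed

section \<open>Bi-invariant functions\<close>

lemma Dleft_deriv:
  assumes "f \<in> Cinf" "k \<in> SU" "X \<in> su"
  shows "((\<lambda>s. f (mexp (s *\<^sub>R X) ** k)) has_real_derivative Im (trace (X ** Dleft f k))) (at 0)"
  using derivs_characterization(3)[OF assms su_zero] by (simp add: cmm.zero_left)

lemma Dright_deriv:
  assumes "f \<in> Cinf" "k \<in> SU" "X \<in> su"
  shows "((\<lambda>s. f (k ** mexp (s *\<^sub>R X))) has_real_derivative Im (trace (X ** Dright f k))) (at 0)"
  using derivs_characterization(3)[OF assms(1,2) su_zero assms(3)] by (simp add: cmm.zero_left)

lemma su_conj:
  assumes "g \<in> SU" "X \<in> su"
  shows "g ** X ** dagger g \<in> su"
  using assms trace_conj[OF SU_D(1)[OF assms(1)], of X]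
  by (simp add: su_def dagger_mult matrix_mul_assoc cmm.minus_left cmm.minus_right)

lemma trace_conj_mult: "trace (g ** X ** h ** P) = trace (X ** (h ** P ** g))"
  for g h X P :: "complex^'m^'m"
  by (metis matrix_mul_assoc trace_mul_sym)

text \<open>Comparing \<open>f (exp(sX) k)\<close> with \<open>f (k exp(s k\<^sup>\<dagger>Xk))\<close>.\<close>

lemma hermitian_part_Dleft_eq:
  fixes f :: "'n::{finite,linorder} cmat \<Rightarrow> real"
  assumes "f \<in> Cinf" "k \<in> SU"
  shows "Dleft f k + dagger (Dleft f k) = k ** (Dright f k + dagger (Dright f k)) ** dagger k"
proof -
  note k = SU_D[OF assms(2)]
  let ?P = "Dleft f k" and ?Q = "Dright f k"
  let ?D = "?P - k ** ?Q ** dagger k"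
  have "dagger ?D = - ?D"
  proof (rule dagger_eq_minus_if_su_orthogonal)
    show "Re (trace ?D) = 0"
      using derivs_characterization(1,2)[OF assms] trace_conj[OF k(1), of ?Q]
      by (simp add: bt_def trace_sub)
    fix X :: "'n cmat"
    assume X: "X \<in> su"
    let ?X = "dagger k ** X ** k"
    have "?X \<in> su"
      using su_conj[OF SU_dagger[OF assms(2)] X] by simp
    moreover have "k ** mexp (s *\<^sub>R ?X) = mexp (s *\<^sub>R X) ** k" for s
      using mexp_conj[OF k(2), of "s *\<^sub>R X"] k(2)
      by (simp add: cmm.scaleR_left cmm.scaleR_right matrix_mul_assoc)
    ultimately have "Im (trace (X ** ?P)) = Im (trace (?X ** ?Q))"
      using Dleft_deriv[OF assms X] Dright_deriv[OF assms, of ?X] by (auto intro: DERIV_unique)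
    then show "Im (trace (X ** ?D)) = 0"
      by (simp add: cmm.diff_right trace_sub trace_conj_mult)
  qed
  then show ?thesis
    by (simp add: dagger_diff dagger_mult cmm.add_left cmm.add_right matrix_mul_assoc algebra_simps)
qed

section \<open>The involution \<open>Isig\<close>, its commutant in \<open>SU\<close>, and block
  structure\<close>

lemma Isig_mult_nth: "(Isig ** A) $ i $ j = Isig $ i $ i * A $ i $ j"
  and mult_Isig_nth: "(A ** Isig) $ i $ j = A $ i $ j * Isig $ j $ j"
proof -
  have "(\<Sum>l\<in>UNIV. Isig $ i $ l * A $ l $ j) = (\<Sum>l\<in>{i}. Isig $ i $ l * A $ l $ j)"
    by (rule sum.mono_neutral_right) (auto simp: Isig_def)
  then show "(Isig ** A) $ i $ j = Isig $ i $ i * A $ i $ j"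
    by (simp add: matrix_matrix_mult_def)
  have "(\<Sum>l\<in>UNIV. A $ i $ l * Isig $ l $ j) = (\<Sum>l\<in>{j}. A $ i $ l * Isig $ l $ j)"
    by (rule sum.mono_neutral_right) (auto simp: Isig_def)
  then show "(A ** Isig) $ i $ j = A $ i $ j * Isig $ j $ j"
    by (simp add: matrix_matrix_mult_def)
qed

lemma Isig_nth [simp]: "Isig $ Inl a $ Inl a = 1" "Isig $ Inr a $ Inr a = - 1"
  by (simp_all add: Isig_def)

lemma dagger_Isig [simp]: "dagger Isig = Isig"
  by (auto simp: vec_eq_iff Isig_def split: sum.splits)

lemma Isig_Isig [simp]: "Isig ** Isig = mat 1"
  by (simp add: vec_eq_iff Isig_mult_nth) (auto simp: Isig_def mat_def split: sum.splits)

text \<open>For unitary \<open>g\<close> the adjoint is the inverse. The commutation form is the one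
  that passes to exponentials.\<close>

lemma Kplus_eq: "Kplus = {g \<in> SU. g ** Isig = Isig ** g}"
proof -
  have "dagger g ** Isig ** g = Isig \<longleftrightarrow> g ** Isig = Isig ** g" if "g \<in> SU" for g
    using SU_D(1,2)[OF that] by (metis matrix_mul_assoc matrix_mul_lid matrix_mul_rid)
  then show ?thesis
    by (auto simp: Kplus_def)
qed

lemma mat_mult_commuting:
  fixes S N :: "complex^'m^'m"
  assumes "S ** N = N ** S"
  shows "mat c ** S ** N = N ** (mat c ** S)"
proof -
  have "mat c ** S ** N = mat c ** N ** S"
    by (simp only: matrix_mul_assoc[symmetric] assms)
  also have "\<dots> = N ** (mat c ** S)"
    by (simp only: mat_mult_commute[of c N] matrix_mul_assoc[symmetric])
  finally show ?thesis .
qed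

lemma involution_conj_commuting:
  fixes Y N :: "complex^'m^'m"
  assumes "N ** N = mat 1" "Y ** N = N ** Y"
  shows "N ** Y ** N = Y"
proof -
  have "N ** Y ** N = N ** (N ** Y)"
    by (simp only: matrix_mul_assoc[symmetric] assms(2))
  also have "\<dots> = Y"
    by (simp only: matrix_mul_assoc assms(1) matrix_mul_lid)
  finally show ?thesis .
qed

text \<open>Since \<open>N\<close> is an involution, commuting with it means being fixed under
  conjugation by it, and conjugation passes through the exponential.\<close>

lemma mexp_commuting:
  fixes X N :: "complex^'m^'m"
  assumes "N ** N = mat 1" "X ** N = N ** X"
  shows "mexp (s *\<^sub>R X) ** N = N ** mexp (s *\<^sub>R X)"
proof -
  have "N ** (s *\<^sub>R X) ** N = s *\<^sub>R X"
    by (rule involution_conj_commuting[OF assms(1)]) (simp add: assms(2) cmm.scaleR_left cmm.scaleR_right)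
  with mexp_conj[OF assms(1), of "s *\<^sub>R X"] have "mexp (s *\<^sub>R X) = N ** mexp (s *\<^sub>R X) ** N"
    by simp
  then show ?thesis
    using assms(1) by (metis matrix_mul_assoc matrix_mul_rid)
qed

text \<open>The hypothesis tests only against the block diagonal part of \<open>su\<close>, so it
  controls the block diagonal part of \<open>P\<close>. That part is again triangular with real
  diagonal, hence vanishes once it is anti-Hermitian.\<close>

lemma bt_strictly_block_upper:
  assumes "P \<in> bt" "\<And>X. X \<in> su \<Longrightarrow> X ** Isig = Isig ** X \<Longrightarrow> Im (trace (X ** P)) = 0"
  shows "Isig ** P = P" "P ** Isig = - P"
proof -
  \<comment> \<open>Twice the block diagonal part of \<open>P\<close>, the off-diagonal blocks
    cancelling. The test element built from it commutes with \<open>Isig\<close>.\<close>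
  let ?D = "P + Isig ** P ** Isig"
  let ?X = "mat \<i> ** (?D + dagger ?D)"
  have trD: "trace ?D = 2 * trace P"
    using trace_conj[OF Isig_Isig, of P] by (simp add: trace_add)
  have "trace P = 0"
    using assms(1) by (simp add: bt_def)
  then have "?X \<in> su"
    using trD
    by (simp add: su_def dagger_mult dagger_mat dagger_add[of ?D] trace_mat_mult trace_add[of ?D] trace_dagger)
      (simp add: vec_eq_iff mat_mult_nth mult_mat_nth)
  moreover have DI: "?D ** Isig = Isig ** ?D" "dagger ?D ** Isig = Isig ** dagger ?D"
    by (simp_all add: dagger_add dagger_mult cmm.add_left cmm.add_right matrix_mul_assoc)
      (simp_all add: matrix_mul_assoc[symmetric])
  then have "(?D + dagger ?D) ** Isig = Isig ** (?D + dagger ?D)"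
    by (simp only: cmm.add_left[of ?D] cmm.add_right[of _ ?D])
  then have XI: "?X ** Isig = Isig ** ?X"
    by (rule mat_mult_commuting)
  ultimately have 1: "Im (trace (?X ** P)) = 0"
    by (rule assms(2))
  \<comment> \<open>The conjugation by \<open>Isig\<close> is moved from \<open>P\<close> to the
    test element, which it fixes; hence both summands of \<open>?D\<close> pair to zero.\<close>
  have "trace (?X ** (Isig ** P ** Isig)) = trace (Isig ** ?X ** Isig ** P)"
    by (rule trace_conj_mult[symmetric])
  also have "Isig ** ?X ** Isig = ?X"
    by (rule involution_conj_commuting[OF Isig_Isig XI])
  finally have "Im (trace (?X ** ?D)) = 0"
    using 1 by (simp only: cmm.add_right trace_add) simp
  then have "?D + dagger ?D = 0"
    by (simp add: trace_hermitian_part)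
  then have "dagger ?D = - ?D"
    by (rule minus_unique[symmetric])
  moreover have D: "?D $ i $ j = P $ i $ j + Isig $ i $ i * P $ i $ j * Isig $ j $ j" for i j
    by (simp add: Isig_mult_nth mult_Isig_nth)
  moreover have "Isig $ i $ i \<in> \<real>" for i :: "'a + 'a"
    by (cases i) auto
  ultimately have "?D = 0"
    using assms(1)
    by (intro upper_triangular_antihermitian_zero)
      (auto simp: bt_def upper_triangular_def simp del: vector_add_component)
  with D have D0: "P $ i $ j + Isig $ i $ i * P $ i $ j * Isig $ j $ j = 0" for i j
    by (metis zero_index)
  \<comment> \<open>The lower left block vanishes by triangularity, as every \<open>Inl\<close>
    index precedes every \<open>Inr\<close> index. Only the upper right block remains.\<close>
  have "P $ Inl a $ Inl b = 0" "P $ Inr a $ Inr b = 0" "P $ Inr a $ Inl b = 0" for a b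
    using D0[of "Inl a" "Inl b"] D0[of "Inr a" "Inr b"] assms(1)
    by (simp_all add: bt_def upper_triangular_def)
  then have "(Isig ** P) $ i $ j = P $ i $ j \<and> (P ** Isig) $ i $ j = - P $ i $ j" for i j
    by (cases i; cases j) (simp_all add: Isig_mult_nth mult_Isig_nth)
  then show "Isig ** P = P" "P ** Isig = - P"
    by (simp_all add: vec_eq_iff)
qed

text \<open>For X in \<open>su\<close> commuting with \<open>Isig\<close>, exp(sX) stays in
  \<open>Kplus\<close>, so \<open>f\<close> is constant along the corresponding left and right
  translates of \<open>k\<close> and the pairings with X vanish.\<close>

lemma Cinf_biinv_block:
  fixes f :: "'n::{finite,linorder} cmat \<Rightarrow> real"
  assumes "f \<in> Cinf_biinv" "k \<in> SU"
  shows "Isig ** Dleft f k = Dleft f k" "Dleft f k ** Isig = - Dleft f k"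
    "Isig ** Dright f k = Dright f k" "Dright f k ** Isig = - Dright f k"
proof -
  have f: "f \<in> Cinf"
    using assms by (simp add: Cinf_biinv_def)
  have Kplus: "mexp (s *\<^sub>R X) \<in> Kplus" if "X \<in> su" "X ** Isig = Isig ** X" for X :: "'n cmat" and s
    using that by (simp add: Kplus_eq mexp_su_in_SU mexp_commuting)
  have "Im (trace (X ** Dleft f k)) = 0" if X: "X \<in> su" "X ** Isig = Isig ** X" for X
  proof -
    have "(\<lambda>s. f (mexp (s *\<^sub>R X) ** k)) = (\<lambda>s. f k)"
      using assms Kplus[OF X] by (auto simp: Cinf_biinv_def)
    then show ?thesis
      using Dleft_deriv[OF f assms(2) X(1)] by (metis DERIV_const DERIV_unique)
  qed
  then show "Isig ** Dleft f k = Dleft f k" "Dleft f k ** Isig = - Dleft f k"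
    using bt_strictly_block_upper[OF derivs_characterization(1)[OF f assms(2)]] by auto
  have "Im (trace (X ** Dright f k)) = 0" if X: "X \<in> su" "X ** Isig = Isig ** X" for X
  proof -
    have "(\<lambda>s. f (k ** mexp (s *\<^sub>R X))) = (\<lambda>s. f k)"
      using assms Kplus[OF X] by (auto simp: Cinf_biinv_def)
    then show ?thesis
      using Dright_deriv[OF f assms(2) X(1)] by (metis DERIV_const DERIV_unique)
  qed
  then show "Isig ** Dright f k = Dright f k" "Dright f k ** Isig = - Dright f k"
    using bt_strictly_block_upper[OF derivs_characterization(2)[OF f assms(2)]] by auto
qed

text \<open>The two group elements form a stabilizer pair: g k (dagger k dagger g k) = k. Invariance
  of \<open>f\<close> under this pair makes conjugation of X by \<open>g\<close> invisible to the
  derivative, so Df(k) is fixed by that conjugation up to an anti-Hermitian matrix.\<close>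

lemma Cinf_biinv_stabilizer_commutes:
  fixes f :: "'n::{finite,linorder} cmat \<Rightarrow> real"
  assumes "f \<in> Cinf_biinv" "k \<in> SU" "g \<in> Kplus" "dagger k ** dagger g ** k \<in> Kplus"
  shows "g ** (Dleft f k + dagger (Dleft f k)) = (Dleft f k + dagger (Dleft f k)) ** g"
proof -
  have f: "f \<in> Cinf"
    using assms by (simp add: Cinf_biinv_def)
  have gSU: "g \<in> SU"
    using assms(3) by (simp add: Kplus_def)
  note g = SU_D[OF gSU] and k = SU_D[OF assms(2)]
  let ?P = "Dleft f k"
  let ?D = "?P - dagger g ** ?P ** g"
  have "dagger ?D = - ?D"
  proof (rule dagger_eq_minus_if_su_orthogonal)
    show "Re (trace ?D) = 0"
      using trace_conj[OF g(2), of ?P] by (simp add: trace_sub)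
    fix X :: "'n cmat"
    assume X: "X \<in> su"
    let ?X = "g ** X ** dagger g"
    have "f (mexp (s *\<^sub>R ?X) ** k) = f (mexp (s *\<^sub>R X) ** k)" for s
    proof -
      have "mexp (s *\<^sub>R ?X) ** k = g ** mexp (s *\<^sub>R X) ** dagger g ** k"
        using mexp_conj[OF g(1), of "s *\<^sub>R X"] by (simp add: cmm.scaleR_left cmm.scaleR_right)
      \<comment> \<open>Inserting k dagger k exhibits the right-hand factor in \<open>Kplus\<close>,
        which bi-invariance removes together with \<open>g\<close>.\<close>
      also have "\<dots> = g ** (mexp (s *\<^sub>R X) ** k ** (dagger k ** dagger g ** k))"
      proof -
        have "g ** (mexp (s *\<^sub>R X) ** k ** (dagger k ** dagger g ** k))
            = g ** mexp (s *\<^sub>R X) ** (k ** dagger k) ** dagger g ** k"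
          by (simp only: matrix_mul_assoc)
        then show ?thesis
          by (simp only: k(2) matrix_mul_rid)
      qed
      finally show ?thesis
        using assms SU_mult[OF mexp_su_in_SU[OF X] assms(2)]
        by (simp add: Cinf_biinv_def SU_mult Kplus_def)
    qed
    then have "Im (trace (?X ** ?P)) = Im (trace (X ** ?P))"
      using Dleft_deriv[OF f assms(2) X] Dleft_deriv[OF f assms(2) su_conj[OF gSU X]]
      by (auto intro: DERIV_unique)
    then show "Im (trace (X ** ?D)) = 0"
      by (simp add: cmm.diff_right trace_sub trace_conj_mult)
  qed
  moreover have "dagger ?D = dagger ?P - dagger g ** dagger ?P ** g"
    by (simp add: dagger_diff dagger_mult matrix_mul_assoc)
  ultimately have "?P + dagger ?P = dagger g ** ?P ** g + dagger g ** dagger ?P ** g"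
    by (simp add: algebra_simps)
  also have "\<dots> = dagger g ** (?P + dagger ?P) ** g"
    by (simp only: cmm.add_left cmm.add_right)
  finally have "?P + dagger ?P = dagger g ** (?P + dagger ?P) ** g" .
  then have "g ** (?P + dagger ?P) = g ** (dagger g ** (?P + dagger ?P) ** g)"
    by (rule arg_cong)
  also have "\<dots> = (?P + dagger ?P) ** g"
    by (simp add: matrix_mul_assoc g)
  finally show ?thesis .
qed

section \<open>Commutation of the Hermitian parts and vanishing of the bracket\<close>

lemma anticommute_mult:
  fixes A B N :: "complex^'m^'m"
  assumes "A ** N = - (N ** A)" "B ** N = - (N ** B)"
  shows "A ** B ** N = N ** (A ** B)"
  by (metis assms cmm.minus_left cmm.minus_right matrix_mul_assoc minus_minus)

lemma commuting_if_mexp_commuting: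
  fixes Z A :: "complex^'m^'m"
  assumes "\<And>s. mexp (s *\<^sub>R Z) ** A = A ** mexp (s *\<^sub>R Z)"
  shows "Z ** A = A ** Z"
proof -
  have "((\<lambda>s. mexp (s *\<^sub>R Z) ** A) has_vector_derivative Z ** A) (at 0)"
    by (rule bounded_linear.has_vector_derivative[OF cmm.bounded_linear_left mexp_has_vector_derivative_0])
  moreover have "((\<lambda>s. A ** mexp (s *\<^sub>R Z)) has_vector_derivative A ** Z) (at 0)"
    by (rule bounded_linear.has_vector_derivative[OF cmm.bounded_linear_right mexp_has_vector_derivative_0])
  ultimately show ?thesis
    unfolding assms by (rule vector_derivative_unique_at)
qed

text \<open>The commutator \<open>Z\<close> satisfies \<open>tr(Z\<^sup>\<dagger>Z) = - tr([A, B]Z) = tr(B[A, Z])\<close>.\<close>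

lemma hermitian_commute_if_commutator_commutes:
  fixes A B :: "complex^'m^'m"
  assumes "dagger A = A" "dagger B = B"
    and comm: "(A ** B - B ** A) ** A = A ** (A ** B - B ** A)"
  shows "A ** B = B ** A"
proof -
  define Z where "Z = A ** B - B ** A"
  have "dagger Z = - Z"
    by (simp add: Z_def dagger_diff dagger_mult assms)
  then have "of_real ((norm Z)\<^sup>2) = - trace (Z ** Z)"
    by (simp add: trace_dagger_mult_self[symmetric] cmm.minus_left trace_minus del: of_real_power)
  also have "trace (Z ** Z) = trace (A ** B ** Z) - trace (B ** A ** Z)"
    by (subst (1) Z_def) (simp only: cmm.diff_left trace_sub)
  also have "trace (B ** A ** Z) = trace (B ** Z ** A)"
    using comm by (simp only: Z_def[symmetric] matrix_mul_assoc[symmetric])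
  also have "\<dots> = trace (A ** B ** Z)"
    by (simp only: matrix_mul_assoc[symmetric] trace_mul_sym[of A])
  finally have "norm Z = 0"
    by simp
  then show ?thesis
    by (simp add: Z_def)
qed

text \<open>\<open>Isig\<close> acts on \<open>P\<close> by +1 from the left and by -1 from the
  right, and on \<open>dagger P\<close> with the signs exchanged. Hence (1 + I)/2 on the left, or (1
  - I)/2 on the right, recovers \<open>P\<close> from its Hermitian part.\<close>

lemma block_upper_hermitian_part:
  assumes "Isig ** P = P" "P ** Isig = - P"
  shows "(P + dagger P) ** Isig = - (Isig ** (P + dagger P))"
    and "P + dagger P + Isig ** (P + dagger P) = 2 *\<^sub>R P"
    and "P + dagger P - (P + dagger P) ** Isig = 2 *\<^sub>R P"
proof -
  have "dagger P ** Isig = dagger P" "Isig ** dagger P = - dagger P"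
    using arg_cong[OF assms(1), of dagger] arg_cong[OF assms(2), of dagger]
    by (simp_all add: dagger_mult dagger_minus)
  with assms show "(P + dagger P) ** Isig = - (Isig ** (P + dagger P))"
    "P + dagger P + Isig ** (P + dagger P) = 2 *\<^sub>R P"
    "P + dagger P - (P + dagger P) ** Isig = 2 *\<^sub>R P"
    by (simp_all add: cmm.add_left cmm.add_right scaleR_2)
qed

text \<open>The block form of D'f(k) gives anticommutation with \<open>Isig\<close> on the
  right-hand side of the group; conjugation by \<open>k\<close> carries it over to \<open>A\<close>
  and \<open>J\<close>.\<close>

lemma Cinf_biinv_anticommute:
  fixes f :: "'n::{finite,linorder} cmat \<Rightarrow> real"
  assumes "f \<in> Cinf_biinv" "k \<in> SU"
  defines "A \<equiv> Dleft f k + dagger (Dleft f k)" and "J \<equiv> k ** Isig ** dagger k"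
  shows "A ** J = - (J ** A)"
proof -
  note k = SU_D[OF assms(2)]
  define B where "B = Dright f k + dagger (Dright f k)"
  have f: "f \<in> Cinf"
    using assms by (simp add: Cinf_biinv_def)
  have A: "A = k ** B ** dagger k"
    unfolding A_def B_def by (rule hermitian_part_Dleft_eq[OF f assms(2)])
  have BI: "B ** Isig = - (Isig ** B)"
    unfolding B_def by (rule block_upper_hermitian_part(1)[OF Cinf_biinv_block(3,4)[OF assms(1,2)]])
  have conj: "k ** M ** dagger k ** (k ** N ** dagger k) = k ** (M ** N) ** dagger k" for M N :: "'n cmat"
  proof -
    have "k ** M ** dagger k ** (k ** N ** dagger k) = k ** M ** (dagger k ** k) ** N ** dagger k"
      by (simp only: matrix_mul_assoc)
    then show ?thesis
      by (simp only: k(1) matrix_mul_rid) (simp only: matrix_mul_assoc)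
  qed
  show ?thesis
    by (simp only: A J_def conj BI cmm.minus_left cmm.minus_right)
qed

text \<open>The stabilizer lemma is applied to the group elements exp(sZ) for all \<open>s\<close>;
  commutation of Z with \<open>A\<close> is then read off by differentiating at s = 0.\<close>

lemma Cinf_biinv_hermitian_parts_commute:
  fixes f h :: "'n::{finite,linorder} cmat \<Rightarrow> real"
  assumes "f \<in> Cinf_biinv" "h \<in> Cinf_biinv" "k \<in> SU"
  defines "A \<equiv> Dleft f k + dagger (Dleft f k)" and "B \<equiv> Dleft h k + dagger (Dleft h k)"
  shows "A ** B = B ** A"
proof -
  note k = SU_D[OF assms(3)]
  let ?Z = "A ** B - B ** A" and ?J = "k ** Isig ** dagger k"
  have herm: "dagger A = A" "dagger B = B"
    by (simp_all add: A_def B_def dagger_add add.commute)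
  have Z: "?Z \<in> su"
    by (simp add: su_def dagger_diff dagger_mult herm trace_sub trace_mul_sym[of A])
  have comm: "?Z ** N = N ** ?Z" if "A ** N = - (N ** A)" "B ** N = - (N ** B)" for N
    by (simp add: cmm.diff_left cmm.diff_right anticommute_mult that)
  have ZI: "?Z ** Isig = Isig ** ?Z"
    unfolding A_def B_def using Cinf_biinv_block assms
    by (intro comm[unfolded A_def B_def] block_upper_hermitian_part(1)) auto
  have ZJ: "?Z ** ?J = ?J ** ?Z"
    unfolding A_def B_def using Cinf_biinv_anticommute assms
    by (intro comm[unfolded A_def B_def]) auto
  have JJ: "?J ** ?J = mat 1"
  proof -
    have "?J ** ?J = k ** (Isig ** (dagger k ** k) ** Isig) ** dagger k"
      by (simp only: matrix_mul_assoc)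
    then show ?thesis
      by (simp add: k(1,2))
  qed
  have "mexp (s *\<^sub>R ?Z) ** A = A ** mexp (s *\<^sub>R ?Z)" for s
  proof -
    let ?g = "mexp (s *\<^sub>R ?Z)" and ?g' = "mexp (- s *\<^sub>R ?Z)"
    have g: "?g \<in> Kplus"
      using mexp_su_in_SU[OF Z] mexp_commuting[OF Isig_Isig ZI] by (simp add: Kplus_eq)
    have "dagger ?Z = - ?Z"
      using Z by (simp only: su_def mem_Collect_eq)
    then have g': "dagger ?g = ?g'"
      by (simp only: dagger_mexp dagger_scaleR scaleR_minus_left scaleR_minus_right)
    have "?g' ** ?J = ?J ** ?g'"
      by (rule mexp_commuting[OF JJ ZJ])
    \<comment> \<open>Conjugation by \<open>k\<close> turns commutation of \<open>?g'\<close> with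
      \<open>?J\<close> into commutation of dagger k \<open>?g'\<close> k with \<open>Isig\<close>,
      that is, membership in \<open>Kplus\<close>.\<close>
    then have "dagger k ** (?g' ** ?J) ** k = dagger k ** (?J ** ?g') ** k"
      by simp
    moreover have "dagger k ** (?g' ** ?J) ** k = dagger k ** ?g' ** k ** Isig ** (dagger k ** k)"
      by (simp only: matrix_mul_assoc)
    moreover have "dagger k ** (?J ** ?g') ** k = (dagger k ** k) ** Isig ** (dagger k ** ?g' ** k)"
      by (simp only: matrix_mul_assoc)
    ultimately have "dagger k ** ?g' ** k ** Isig = Isig ** (dagger k ** ?g' ** k)"
      by (simp only: k(1) matrix_mul_lid matrix_mul_rid)
    then have "dagger k ** dagger ?g ** k \<in> Kplus"
      using mexp_su_in_SU[OF Z, of "- s"] by (simp only: Kplus_eq g') (auto intro!: SU_mult SU_dagger assms(3))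
    from Cinf_biinv_stabilizer_commutes[OF assms(1,3) g this] show ?thesis
      by (simp only: A_def)
  qed
  then have "?Z ** A = A ** ?Z"
    by (rule commuting_if_mexp_commuting)
  with herm show ?thesis
    by (rule hermitian_commute_if_commutator_commutes)
qed

theorem lemma2p1:
  fixes f h :: "'n::{finite,linorder} cmat \<Rightarrow> real"
  assumes "f \<in> Cinf_biinv" and "h \<in> Cinf_biinv"
  shows "\<forall>k\<in>SU. poisson f h k = 0"
proof
  fix k :: "'n cmat"
  assume kSU: "k \<in> SU"
  note k = SU_D[OF kSU]
  let ?P = "Dleft f k" and ?Q = "Dright h k"
  define A where "A = ?P + dagger ?P"
  define B where "B = Dleft h k + dagger (Dleft h k)"
  define C where "C = ?Q + dagger ?Q"
  define J where "J = k ** Isig ** dagger k"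
  have herm: "dagger A = A" "dagger B = B" "dagger J = J"
    by (simp_all add: A_def B_def J_def dagger_add dagger_mult add.commute matrix_mul_assoc)
  have anti: "A ** Isig = - (Isig ** A)" "B ** Isig = - (Isig ** B)"
    unfolding A_def B_def
    by (rule block_upper_hermitian_part(1)[OF Cinf_biinv_block(1,2)[OF assms(1) kSU]],
        rule block_upper_hermitian_part(1)[OF Cinf_biinv_block(1,2)[OF assms(2) kSU]])
  have AB: "A ** B = B ** A"
    unfolding A_def B_def by (rule Cinf_biinv_hermitian_parts_commute[OF assms kSU])
  have P: "2 *\<^sub>R ?P = A + Isig ** A"
    unfolding A_def by (rule block_upper_hermitian_part(2)[OF Cinf_biinv_block(1,2)[OF assms(1) kSU], symmetric])
  \<comment> \<open>Conjugating D'h(k) = C (1 - I)/2 by \<open>k\<close> turns \<open>C\<close> into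
    \<open>B\<close> and \<open>Isig\<close> into \<open>J\<close>, so both factors of the bracket
    are expressed through left derivatives.\<close>
  have Q: "2 *\<^sub>R (k ** ?Q ** dagger k) = B - B ** J"
  proof -
    have "B = k ** C ** dagger k"
      unfolding B_def C_def using assms(2) kSU by (intro hermitian_part_Dleft_eq) (simp_all add: Cinf_biinv_def)
    moreover have "k ** C ** dagger k ** J = k ** C ** (dagger k ** k) ** Isig ** dagger k"
      by (simp only: J_def matrix_mul_assoc)
    moreover have "2 *\<^sub>R ?Q = C - C ** Isig"
      unfolding C_def by (rule block_upper_hermitian_part(3)[OF Cinf_biinv_block(3,4)[OF assms(2) kSU], symmetric])
    then have "k ** (2 *\<^sub>R ?Q) ** dagger k = k ** (C - C ** Isig) ** dagger k"
      by (rule arg_cong)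
    ultimately show ?thesis
      by (simp only: k(1) matrix_mul_rid cmm.scaleR_left cmm.scaleR_right cmm.diff_left cmm.diff_right
          matrix_mul_assoc)
  qed
  \<comment> \<open>\<open>?S\<close> is Hermitian because \<open>A\<close> and \<open>B\<close>
    commute. \<open>Isig ** ?S\<close> is Hermitian because both factors anticommute with
    \<open>Isig\<close>, so that their product commutes with it.\<close>
  let ?S = "A ** B"
  have S: "dagger ?S = ?S"
    by (simp add: dagger_mult herm AB)
  have IS: "?S ** Isig = Isig ** ?S"
    by (rule anticommute_mult[OF anti])
  have ISh: "dagger (Isig ** ?S) = Isig ** ?S"
    by (simp only: dagger_mult[of Isig] S dagger_Isig IS)
  \<comment> \<open>The identity serves as the second Hermitian factor in those two summands of (1 +
    I) S (1 - J) that do not contain \<open>J\<close>.\<close>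
  have one: "dagger (mat 1 :: 'n cmat) = mat 1"
    by (simp add: dagger_mat)
  have "(2 *\<^sub>R ?P) ** (2 *\<^sub>R (k ** ?Q ** dagger k))
      = ?S ** mat 1 - ?S ** J + (Isig ** ?S ** mat 1 - Isig ** ?S ** J)"
    unfolding P Q by (simp add: cmm.add_left cmm.diff_right matrix_mul_assoc)
  then have "Im (trace ((2 *\<^sub>R ?P) ** (2 *\<^sub>R (k ** ?Q ** dagger k)))) = 0"
    using trace_hermitian_mult[OF S one] trace_hermitian_mult[OF S herm(3)]
      trace_hermitian_mult[OF ISh one] trace_hermitian_mult[OF ISh herm(3)]
    by (simp only: trace_add trace_sub) simp
  moreover have "(2 *\<^sub>R M) ** (2 *\<^sub>R N) = mat 4 ** (M ** N)" for M N :: "'n cmat"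
    by (simp add: cmm.scaleR_left cmm.scaleR_right vec_eq_iff mat_mult_nth scaleR_conv_of_real[where 'a=complex])
  ultimately have "Im (trace (?P ** (k ** ?Q ** dagger k))) = 0"
    by (simp add: trace_mat_mult)
  then show "poisson f h k = 0"
    by (simp add: poisson_def k(4) matrix_mul_assoc)
qed

end
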